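(* Let $\mu$ be a compactly supported probability measure on $\mathbb{R}^d$ with a density with respect to the Lebesgue measure, and suppose that $\mu$ is a product measure, $d\mu(\mathbf{x})=\prod_{i=1}^d d\mu_i(x_i)$, with $\mu_1,\dots,\mu_d$ finite Borel measures on $\mathbb{R}$. Let $G$ be any graphical model for $\mu$, and $J$ any junction tree for $G$. Then for all $n\in\mathbb{N}$ and all $\mathbf{x}\in\mathbb{R}^d$, $$\Gamma_n^{\mu,G,J}(\mathbf{x})=\prod_{i=1}^d\Lambda_n^{\mu_i}(x_i)=\Lambda_{\otimes n}^{\mu}(\mathbf{x}),$$ where $\Gamma_n^{\mu,G,J}$ is the rational Christoffel function of $\mu$ associated with $G$ and $J$, $\Lambda_n^{\mu_i}$ is the univariate Christoffel polynomial of $\mu_i$, and $\Lambda_{\otimes n}^\mu$ is the coordinate-wise Christoffel polynomial of $\mu$.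
   Context: Notation. $[d]=\{1,\dots,d\}$. For $A\subseteq[d]$, $\mathbb{R}^d_A$ is the span of the standard basis vectors $e_k$, $k\in A$, and $\mathbf{x}_A=(x_k)_{k\in A}$ is the projection of $\mathbf{x}\in\mathbb{R}^d$ onto it. With $f$ the density of $\mu$, $\mu_A$ is the marginal of $\mu$ on $\mathbb{R}^d_A$, with density $f_A(\mathbf{x}_A)=\int f(\mathbf{x}_A,\mathbf{x}_{[d]\setminus A})\,d\mathbf{x}_{[d]\setminus A}$ (and $f_\emptyset=1$). Graphical models. For $A,B,C\subseteq[d]$, $A\perp_\mu B\,|\,C$ (conditional independence) means $f_C(\mathbf{x}_C)\,f_{A\cup B\cup C}(\mathbf{x}_{A\cup B\cup C})=f_{A\cup C}(\mathbf{x}_{A\cup C})\,f_{B\cup C}(\mathbf{x}_{B\cup C})$, as an identity of densities (for almost every $\mathbf{x}$). In a simple graph $G$ on vertex set $[d]$, $A,B$ are separated by $C$ if every path (including one-vertex paths) between a vertex of $A$ and a vertex of $B$ contains a vertex of $C$. $G$ is a graphical model for $\mu$ if for all $A,B,C\subseteq[d]$: $A,B$ separated by $C$ in $G$ implies $A\perp_\mu B\,|\,C$. Junction trees. A graph is chordal if every cycle of length greater than 3 has a chord. A chordal completion of $G$ is a chordal graph $\overline G$ on the same vertex set with $E(G)\subseteq E(\overline G)$. A junction tree $J$ for $G$ is a tree whose vertex set $V(J)$ is the set of maximal cliques of some chordal completion of $G$, with the clique-intersection property: for every $C\in V(J)$ on the path between $A,B\in V(J)$ in $J$, $A\cap B\subseteq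 C$. $E(J)$ denotes its edge set. Christoffel polynomials. For $D\subseteq[d]$ and $n\in\mathbb{N}$, $\mathbb{R}[\mathbf{x}_D]_{\otimes n}$ is the space of real polynomials in the variables $x_k$, $k\in D$, of degree at most $n$ in each variable. The coordinate-wise Christoffel polynomial of $\mu_D$ is $\Lambda_{\otimes n}^{\mu_D}(\mathbf{x}_D)=\sum_k P_k(\mathbf{x}_D)^2$, where $\{P_k\}$ is any orthonormal basis of $\mathbb{R}[\mathbf{x}_D]_{\otimes n}$ for the inner product $\langle p,q\rangle_{\mu_D}=\int pq\,d\mu_D$; $\Lambda_{\otimes n}^\mu$ is the case $D=[d]$, and $\Lambda_{\otimes n}^{\mu_\emptyset}=1$. For a measure $\mu_i$ on $\mathbb{R}$, $\Lambda_n^{\mu_i}(x_i)=\sum_{j=0}^nP_{i,j}(x_i)^2$ with $\{P_{i,0},\dots,P_{i,n}\}$ any orthonormal basis of the univariate polynomials of degree at most $n$ with respect to $\langle p,q\rangle_{\mu_i}=\int pq\,d\mu_i$. Rational Christoffel function: $$\Gamma_n^{\mu,G,J}(\mathbf{x})=\frac{\prod_{C\in V(J)}\Lambda_{\otimes n}^{\mu_C}(\mathbf{x}_C)}{\prod_{\{A,B\}\in E(J)}\Lambda_{\otimes n}^{\mu_{A\cap B}}(\mathbf{x}_{A\cap B})}.$$ *)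

theory Defs
  imports "HOL-Probability.Probability"
begin

section \<open>Finite simple graphs and junction trees\<close>

text \<open>
  A graph is a pair of a vertex set and a set of two-element edges \<open>{u, v}\<close>. Digraph libraries
  are not used because a symmetric digraph with an edge always has a directed cycle of length 2.
\<close>

type_synonym 'v graph = "'v set \<times> 'v set set"

abbreviation verts :: "'v graph \<Rightarrow> 'v set" where "verts \<equiv> fst"
abbreviation edges :: "'v graph \<Rightarrow> 'v set set" where "edges \<equiv> snd"

definition simple_graph :: "'v graph \<Rightarrow> bool" where
  "simple_graph G \<longleftrightarrow> finite (verts G) \<and> (\<forall>e\<in>edges G. e \<subseteq> verts G \<and> card e = 2)"

definition graph_path :: "'v graph \<Rightarrow> 'v list \<Rightarrow> bool" where
  "graph_path G p \<longleftrightarrow>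
     p \<noteq> [] \<and> distinct p \<and> set p \<subseteq> verts G \<and> successively (\<lambda>u v. {u, v} \<in> edges G) p"

definition cycle_edges :: "'v list \<Rightarrow> 'v set set" where
  "cycle_edges p = {{p ! i, p ! (Suc i mod length p)} | i. i < length p}"

text \<open>A cycle is listed without repeating its first vertex, so its length is the list length.\<close>

definition graph_cycle :: "'v graph \<Rightarrow> 'v list \<Rightarrow> bool" where
  "graph_cycle G p \<longleftrightarrow>
     3 \<le> length p \<and> distinct p \<and> set p \<subseteq> verts G \<and> cycle_edges p \<subseteq> edges G"

definition has_chord :: "'v graph \<Rightarrow> 'v list \<Rightarrow> bool" where
  "has_chord G p \<longleftrightarrow> (\<exists>e\<in>edges G. e \<subseteq> set p \<and> e \<notin> cycle_edges p)"

definition chordal :: "'v graph \<Rightarrow> bool" where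
  "chordal G \<longleftrightarrow> (\<forall>p. graph_cycle G p \<and> 3 < length p \<longrightarrow> has_chord G p)"

definition chordal_completion :: "'v graph \<Rightarrow> 'v graph \<Rightarrow> bool" where
  "chordal_completion G H \<longleftrightarrow>
     simple_graph H \<and> chordal H \<and> verts H = verts G \<and> edges G \<subseteq> edges H"

definition clique :: "'v graph \<Rightarrow> 'v set \<Rightarrow> bool" where
  "clique G K \<longleftrightarrow> K \<subseteq> verts G \<and> (\<forall>u\<in>K. \<forall>v\<in>K. u \<noteq> v \<longrightarrow> {u, v} \<in> edges G)"

definition maximal_cliques :: "'v graph \<Rightarrow> 'v set set" where
  "maximal_cliques G = {K. clique G K \<and> (\<forall>L. clique G L \<and> K \<subseteq> L \<longrightarrow> L = K)}"

definition is_tree :: "'v graph \<Rightarrow> bool" where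
  "is_tree T \<longleftrightarrow>
     simple_graph T \<and> verts T \<noteq> {} \<and>
     (\<forall>u\<in>verts T. \<forall>v\<in>verts T. \<exists>p. graph_path T p \<and> hd p = u \<and> last p = v) \<and>
     (\<nexists>p. graph_cycle T p)"

definition junction_tree :: "'v graph \<Rightarrow> 'v set graph \<Rightarrow> bool" where
  "junction_tree G J \<longleftrightarrow>
     is_tree J \<and>
     (\<exists>H. chordal_completion G H \<and> verts J = maximal_cliques H) \<and>
     (\<forall>p. graph_path J p \<longrightarrow> (\<forall>C\<in>set p. hd p \<inter> last p \<subseteq> C))"

definition separated :: "'v graph \<Rightarrow> 'v set \<Rightarrow> 'v set \<Rightarrow> 'v set \<Rightarrow> bool" where
  "separated G A B C \<longleftrightarrow>
     (\<forall>p. graph_path G p \<and> hd p \<in> A \<and> last p \<in> B \<longrightarrow> set p \<inter> C \<noteq> {})"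


section \<open>Marginals and graphical models\<close>

text \<open>
  The coordinates \<open>[d]\<close> are the finite index type \<open>'d\<close>. The projection onto the span of the
  basis vectors indexed by \<open>A\<close> is a vector of the ambient space, with zeros outside \<open>A\<close>.
\<close>

definition coord_proj :: "'d set \<Rightarrow> real ^ 'd \<Rightarrow> real ^ 'd" where
  "coord_proj A x = (\<chi> k. if k \<in> A then x $ k else 0)"

definition marginal :: "'d set \<Rightarrow> (real ^ 'd::finite) measure \<Rightarrow> (real ^ 'd) measure" where
  "marginal A M = distr M borel (coord_proj A)"

text \<open>The value at \<open>x\<close> depends only on the coordinates of \<open>x\<close> in \<open>A\<close>.\<close>

definition marginal_density ::
  "(real ^ 'd::finite \<Rightarrow> ennreal) \<Rightarrow> 'd set \<Rightarrow> real ^ 'd \<Rightarrow> ennreal" where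
  "marginal_density f A x =
     (\<integral>\<^sup>+ y. f (\<chi> k. if k \<in> A then x $ k else y k) \<partial>(\<Pi>\<^sub>M k\<in>- A. lborel))"

definition cond_indep ::
  "(real ^ 'd::finite \<Rightarrow> ennreal) \<Rightarrow> 'd set \<Rightarrow> 'd set \<Rightarrow> 'd set \<Rightarrow> bool" where
  "cond_indep f A B C \<longleftrightarrow>
     (AE x in lborel.
        marginal_density f C x * marginal_density f (A \<union> B \<union> C) x =
        marginal_density f (A \<union> C) x * marginal_density f (B \<union> C) x)"

definition graphical_model :: "'d graph \<Rightarrow> (real ^ 'd::finite \<Rightarrow> ennreal) \<Rightarrow> bool" where
  "graphical_model G f \<longleftrightarrow>
     simple_graph G \<and> verts G = UNIV \<and>
     (\<forall>A B C. separated G A B C \<longrightarrow> cond_indep f A B C)"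

definition measure_support :: "'a::topological_space measure \<Rightarrow> 'a set" where
  "measure_support M = {x. \<forall>U. open U \<and> x \<in> U \<longrightarrow> 0 < emeasure M U}"


section \<open>Christoffel polynomials\<close>

text \<open>Here \<open>V\<close> is a linear space of functions, and integration against \<open>M\<close> the inner product.\<close>

definition orthonormal_basis ::
  "'a measure \<Rightarrow> ('a \<Rightarrow> real) set \<Rightarrow> ('a \<Rightarrow> real) set \<Rightarrow> bool" where
  "orthonormal_basis M V B \<longleftrightarrow>
     finite B \<and> B \<subseteq> V \<and>
     (\<forall>p\<in>B. \<forall>q\<in>B. (\<integral>x. p x * q x \<partial>M) = (if p = q then 1 else 0)) \<and>
     (\<forall>v\<in>V. \<exists>c. v = (\<lambda>x. \<Sum>p\<in>B. c p * p x))"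

text \<open>The choice of the basis is irrelevant, see \<open>christoffel_eq\<close> below.\<close>

definition christoffel :: "'a measure \<Rightarrow> ('a \<Rightarrow> real) set \<Rightarrow> 'a \<Rightarrow> real" where
  "christoffel M V x = (\<Sum>p\<in>(SOME B. orthonormal_basis M V B). (p x)\<^sup>2)"

definition univ_polys :: "nat \<Rightarrow> (real \<Rightarrow> real) set" where
  "univ_polys n = {poly p | p. degree p \<le> n}"

text \<open>Polynomial functions in the variables \<open>x $ k\<close>, \<open>k \<in> D\<close>; \<open>c a\<close> is the coefficient of the
  monomial with exponent vector \<open>a\<close>, whose entries are all at most \<open>n\<close>.\<close>

definition tensor_polys :: "'d set \<Rightarrow> nat \<Rightarrow> (real ^ 'd \<Rightarrow> real) set" where
  "tensor_polys D n =
     {\<lambda>x. \<Sum>a\<in>(\<Pi>\<^sub>E k\<in>D. {..n}). c a * (\<Prod>k\<in>D. (x $ k) ^ a k) | c. True}"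

definition univ_christoffel :: "nat \<Rightarrow> real measure \<Rightarrow> real \<Rightarrow> real" where
  "univ_christoffel n \<nu> = christoffel \<nu> (univ_polys n)"

definition coord_christoffel ::
  "'d set \<Rightarrow> nat \<Rightarrow> (real ^ 'd::finite) measure \<Rightarrow> real ^ 'd \<Rightarrow> real" where
  "coord_christoffel D n \<nu> = christoffel \<nu> (tensor_polys D n)"

text \<open>For an edge \<open>e = {A, B}\<close> of \<open>J\<close>, the intersection \<open>A \<inter> B\<close> is \<open>\<Inter>e\<close>.\<close>

definition rational_christoffel ::
  "nat \<Rightarrow> (real ^ 'd::finite) measure \<Rightarrow> 'd set graph \<Rightarrow> real ^ 'd \<Rightarrow> real" where
  "rational_christoffel n M J x =
     (\<Prod>C\<in>verts J. coord_christoffel C n (marginal C M) (coord_proj C x)) /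
     (\<Prod>e\<in>edges J. coord_christoffel (\<Inter>e) n (marginal (\<Inter>e) M) (coord_proj (\<Inter>e) x))"

lemma orthonormal_basis_sum_squares_unique:
  assumes B: "orthonormal_basis M V B" and B': "orthonormal_basis M V B'"
    and int: "\<And>p q. p \<in> V \<Longrightarrow> q \<in> V \<Longrightarrow> integrable M (\<lambda>x. p x * q x)"
  shows "(\<Sum>p\<in>B. (p x)\<^sup>2) = (\<Sum>p\<in>B'. (p x)\<^sup>2)"
proof -
  have expand: "v y = (\<Sum>p\<in>A. (\<integral>x. v x * p x \<partial>M) * p y)"
    if A: "orthonormal_basis M V A" and v: "v \<in> V" for A v y
  proof -
    obtain c where c: "v = (\<lambda>x. \<Sum>p\<in>A. c p * p x)"
      using A v unfolding orthonormal_basis_def by blast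
    have fin: "finite A" and sub: "A \<subseteq> V"
      and orth: "\<And>p q. p \<in> A \<Longrightarrow> q \<in> A \<Longrightarrow> (\<integral>x. p x * q x \<partial>M) = (if p = q then 1 else 0)"
      using A unfolding orthonormal_basis_def by blast+
    have "(\<integral>x. v x * p x \<partial>M) = c p" if p: "p \<in> A" for p
    proof -
      have "(\<integral>x. v x * p x \<partial>M) = (\<integral>x. (\<Sum>q\<in>A. c q * (q x * p x)) \<partial>M)"
        by (simp add: c sum_distrib_right mult.assoc)
      also have "\<dots> = (\<Sum>q\<in>A. (\<integral>x. c q * (q x * p x) \<partial>M))"
        using p sub by (intro Bochner_Integration.integral_sum integrable_mult_right int) auto
      also have "\<dots> = (\<Sum>q\<in>A. c q * (if q = p then 1 else 0))"
        using p by (intro sum.cong refl) (simp add: orth)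
      also have "\<dots> = c p"
        using fin p by (simp add: sum.delta if_distrib cong: if_cong)
      finally show ?thesis .
    qed
    then show ?thesis
      by (subst c) (simp cong: sum.cong)
  qed
  have sub: "B \<subseteq> V" "B' \<subseteq> V"
    using B B' unfolding orthonormal_basis_def by auto
  have "(\<Sum>p\<in>B. (p x)\<^sup>2) = (\<Sum>p\<in>B. p x * (\<Sum>q\<in>B'. (\<integral>y. p y * q y \<partial>M) * q x))"
    using expand[OF B'] sub(1) by (intro sum.cong refl) (auto simp: power2_eq_square)
  also have "\<dots> = (\<Sum>q\<in>B'. q x * (\<Sum>p\<in>B. (\<integral>y. q y * p y \<partial>M) * p x))"
    unfolding sum_distrib_left by (subst sum.swap) (simp add: mult_ac)
  also have "\<dots> = (\<Sum>p\<in>B'. (p x)\<^sup>2)"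
    using expand[OF B, symmetric] sub(2) by (intro sum.cong refl) (auto simp: power2_eq_square)
  finally show ?thesis .
qed

lemma christoffel_eq:
  assumes "orthonormal_basis M V B"
    and "\<And>p q. p \<in> V \<Longrightarrow> q \<in> V \<Longrightarrow> integrable M (\<lambda>x. p x * q x)"
  shows "christoffel M V x = (\<Sum>p\<in>B. (p x)\<^sup>2)"
  unfolding christoffel_def
  by (rule orthonormal_basis_sum_squares_unique[OF someI[of "orthonormal_basis M V"]])
     (use assms in auto)

lemma coord_christoffel_empty:
  assumes "prob_space M" and "sets M = sets borel"
  shows "coord_christoffel {} n (marginal {} M) x = 1"
proof -
  interpret prob_space M by fact
  have "coord_proj {} \<in> measurable M borel"
    by (simp add: coord_proj_def[abs_def])
  then interpret N: prob_space "marginal {} M"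
    unfolding marginal_def by (rule prob_space_distr)
  have polys: "tensor_polys {} n = range (\<lambda>c x. c)"
    by (auto simp: tensor_polys_def image_iff intro!: exI[of _ "\<lambda>_. _"])
  have "orthonormal_basis (marginal {} M) (tensor_polys {} n) {\<lambda>x. 1}"
    unfolding orthonormal_basis_def polys by (auto simp: N.prob_space)
  then show ?thesis
    unfolding coord_christoffel_def
    by (subst christoffel_eq) (auto simp: polys)
qed

end

theory Submission
  imports Defs
begin

text \<open>
  The identity rests on two independent facts, one on measures and one on trees.

  Let \<open>m\<^sub>k\<close> be the total mass of \<open>\<mu>\<^sub>k\<close>, so that \<open>\<Prod>\<^sub>k m\<^sub>k = 1\<close>. The marginal of \<open>M\<close> on
  \<open>C\<close> is the product of the \<open>\<mu>\<^sub>k\<close> with \<open>k \<in> C\<close>, times the constant \<open>\<Prod>\<^sub>k\<^sub>\<notin>\<^sub>C m\<^sub>k\<close>. Products of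
  univariate orthonormal polynomials, rescaled by the factors \<open>\<surd>m\<^sub>k\<close>, are therefore an orthonormal
  basis of the tensor polynomials, and the Christoffel polynomial of the marginal is
  \<open>\<Prod>\<^sub>k\<^sub>\<in>\<^sub>C a\<^sub>k\<close> with \<open>a\<^sub>k = m\<^sub>k \<Lambda>\<^sub>n(\<mu>\<^sub>k)(x\<^sub>k)\<close> (\<open>coord_christoffel_marginal\<close>). The masses
  appear because the \<open>\<mu>\<^sub>k\<close> are only finite measures; they cancel when \<open>C\<close> is the full index set.

  The cliques of a junction tree that contain a given vertex \<open>i\<close> span a subtree, by
  the clique-intersection property, and the edges of this subtree are the edges \<open>{A, B}\<close> with
  \<open>i \<in> A \<inter> B\<close>. A tree has one vertex more than it has edges, so in the quotient that defines the
  rational Christoffel function each \<open>a\<^sub>i\<close> survives with exponent exactly 1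
  (\<open>junction_tree_prod_quotient\<close>).

  What remains is that univariate orthonormal polynomials exist. Gram-Schmidt needs finite moments
  and a positive definite form. Compactness of the support of \<open>M\<close> bounds each \<open>\<mu>\<^sub>k\<close>, which gives the
  moments; the density of \<open>M\<close> excludes atoms of \<open>\<mu>\<^sub>k\<close>, so that the finitely many roots of a nonzero
  polynomial are a null set, which gives definiteness.
\<close>

section \<open>Counting vertices and edges of a tree\<close>

text \<open>
  The first vertex of a longest path is a leaf: a neighbour outside the path would extend it, and a
  neighbour on the path other than the second vertex would close a cycle.
\<close>
lemma tree_has_leaf:
  assumes T: "is_tree T" and two: "1 < card (verts T)"
  obtains v w where "{v, w} \<in> edges T" "v \<noteq> w" "\<And>e. e \<in> edges T \<Longrightarrow> v \<in> e \<Longrightarrow> e = {v, w}"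
proof -
  have simple: "finite (verts T)" "\<And>e. e \<in> edges T \<Longrightarrow> e \<subseteq> verts T \<and> card e = 2"
    and conn: "\<And>u v. u \<in> verts T \<Longrightarrow> v \<in> verts T \<Longrightarrow> \<exists>p. graph_path T p \<and> hd p = u \<and> last p = v"
    and acyclic: "\<And>p. \<not> graph_cycle T p"
    using T unfolding is_tree_def simple_graph_def by blast+
  obtain a b where ab: "a \<in> verts T" "b \<in> verts T" "a \<noteq> b"
    using two card_le_Suc0_iff_eq[OF simple(1)] by (metis One_nat_def not_le)
  obtain q where q: "graph_path T q" "hd q = a" "last q = b"
    using conn ab by blast
  have q2: "2 \<le> length q"
    using q ab(3) unfolding graph_path_def
    by (cases q rule: list.exhaust; cases "tl q") auto
  have bound: "length p \<le> card (verts T)" if "graph_path T p" for p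
    using that simple(1) unfolding graph_path_def by (metis card_mono distinct_card)
  obtain p where p: "graph_path T p"
    and longest: "\<And>r. graph_path T r \<Longrightarrow> length r \<le> length p"
    using ex_has_greatest_nat[of "graph_path T" q length "Suc (card (verts T))"] q(1) bound
    by (auto simp: le_imp_less_Suc)
  have p2: "2 \<le> length p"
    using longest[OF q(1)] q2 by linarith
  have p_props: "p \<noteq> []" "distinct p" "set p \<subseteq> verts T"
    and p_step: "\<And>i. Suc i < length p \<Longrightarrow> {p ! i, p ! Suc i} \<in> edges T"
    using p unfolding graph_path_def by (auto simp: successively_conv_nth)
  show ?thesis
  proof (rule that[of "p ! 0" "p ! 1"])
    show "{p ! 0, p ! 1} \<in> edges T" "p ! 0 \<noteq> p ! 1"
      using p_step[of 0] p2 p_props(1) nth_eq_iff_index_eq[OF p_props(2), of 0 1] by simp_all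
  next
    fix e assume e: "e \<in> edges T" "p ! 0 \<in> e"
    then obtain u where u: "e = {p ! 0, u}" "u \<noteq> p ! 0"
      using simple(2)[OF e(1)] by (auto simp: card_2_iff)
    have "u \<in> set p"
    proof (rule ccontr)
      assume "u \<notin> set p"
      moreover have "u \<in> verts T"
        using simple(2)[OF e(1)] u by auto
      ultimately have "graph_path T (u # p)"
        using p e u unfolding graph_path_def
        by (auto simp: successively_Cons hd_conv_nth insert_commute)
      then show False
        using longest by fastforce
    qed
    then obtain j where j: "j < length p" "u = p ! j"
      by (metis in_set_conv_nth)
    have "j = 1"
    proof (rule ccontr)
      assume "j \<noteq> 1"
      then have j2: "2 \<le> j"
        using j u(2) by (cases j; cases "j - 1") auto
      have len: "length (take (Suc j) p) = Suc j"
        using j by simp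
      have "cycle_edges (take (Suc j) p) \<subseteq> edges T"
      proof -
        have "{p ! i, p ! (Suc i mod Suc j)} \<in> edges T" if "i < Suc j" for i
        proof (cases "i = j")
          case True
          then show ?thesis
            using e(1) u(1) j(2) by (simp add: insert_commute)
        next
          case False
          then show ?thesis
            using that p_step[of i] j(1) by simp
        qed
        then show ?thesis
          unfolding cycle_edges_def len by (auto simp: mod_less_divisor)
      qed
      then have "graph_cycle T (take (Suc j) p)"
        unfolding graph_cycle_def len using j2 p_props set_take_subset[of "Suc j" p]
        by (auto simp: distinct_take)
      then show False
        using acyclic by blast
    qed
    then show "e = {p ! 0, p ! 1}"
      using u j by simp
  qed
qed

text \<open>
  A path between two other vertices cannot pass through the leaf, since it would have to visit the
  only neighbour of the leaf both before and after it.
\<close>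
lemma tree_remove_leaf:
  assumes T: "is_tree T" and vw: "{v, w} \<in> edges T" "v \<noteq> w"
    and leaf: "\<And>e. e \<in> edges T \<Longrightarrow> v \<in> e \<Longrightarrow> e = {v, w}"
  shows "is_tree (verts T - {v}, edges T - {{v, w}})" (is "is_tree ?T")
proof -
  have simple: "finite (verts T)" "\<And>e. e \<in> edges T \<Longrightarrow> e \<subseteq> verts T \<and> card e = 2"
    and conn: "\<And>u v. u \<in> verts T \<Longrightarrow> v \<in> verts T \<Longrightarrow> \<exists>p. graph_path T p \<and> hd p = u \<and> last p = v"
    and acyclic: "\<And>p. \<not> graph_cycle T p"
    using T unfolding is_tree_def simple_graph_def by blast+
  have "simple_graph ?T"
    unfolding simple_graph_def using simple leaf by auto
  moreover have "w \<in> verts ?T"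
    using simple(2)[OF vw(1)] vw(2) by simp
  moreover have "\<not> graph_cycle ?T p" for p
    using acyclic[of p] unfolding graph_cycle_def by auto
  moreover have "\<exists>p. graph_path ?T p \<and> hd p = a \<and> last p = b"
    if "a \<in> verts ?T" "b \<in> verts ?T" for a b
  proof -
    have ab: "a \<in> verts T" "b \<in> verts T" "a \<noteq> v" "b \<noteq> v"
      using that by auto
    obtain p where p: "graph_path T p" "hd p = a" "last p = b"
      using conn[OF ab(1,2)] by blast
    have p_props: "p \<noteq> []" "distinct p" "set p \<subseteq> verts T"
      and p_step: "\<And>i. Suc i < length p \<Longrightarrow> {p ! i, p ! Suc i} \<in> edges T"
      using p unfolding graph_path_def by (auto simp: successively_conv_nth)
    have avoid: "v \<notin> set p"
    proof
      assume "v \<in> set p"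
      then obtain i where i: "i < length p" "p ! i = v"
        by (metis in_set_conv_nth)
      have "i \<noteq> 0"
        using i ab(3) p(2) p_props(1) by (auto simp: hd_conv_nth intro: gr0I)
      then obtain h where h: "i = Suc h"
        by (cases i) auto
      have "Suc i \<noteq> length p"
        using i ab(4) p(3) p_props(1) by (metis diff_Suc_1 last_conv_nth)
      then have Suc_i: "Suc i < length p"
        using i by simp
      have "p ! h = w" "p ! Suc i = w"
        using p_step[of h] p_step[of i] leaf i h Suc_i vw(2) by (fastforce simp: doubleton_eq_iff)+
      then show False
        using nth_eq_iff_index_eq[OF p_props(2), of h "Suc i"] h Suc_i by simp
    qed
    have "{p ! i, p ! Suc i} \<noteq> {v, w}" if "Suc i < length p" for i
      using avoid that nth_mem[of i p] nth_mem[of "Suc i" p] by (auto simp: doubleton_eq_iff)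
    then have "graph_path ?T p"
      using p_props p_step avoid unfolding graph_path_def by (auto simp: successively_conv_nth)
    then show ?thesis
      using p by blast
  qed
  ultimately show ?thesis
    unfolding is_tree_def by blast
qed

lemma tree_card_verts:
  assumes "is_tree T"
  shows "card (verts T) = Suc (card (edges T))"
  using assms
proof (induction "card (verts T)" arbitrary: T rule: less_induct)
  case less
  have fin: "finite (verts T)" and ne: "verts T \<noteq> {}"
    and edge: "\<And>e. e \<in> edges T \<Longrightarrow> e \<subseteq> verts T \<and> card e = 2"
    using less.prems unfolding is_tree_def simple_graph_def by blast+
  have finE: "finite (edges T)"
    using edge fin by (meson finite_Pow_iff finite_subset PowI subsetI)
  show ?case
  proof (cases "1 < card (verts T)")
    case True
    obtain v w where vw: "{v, w} \<in> edges T" "v \<noteq> w"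
      and leaf: "\<And>e. e \<in> edges T \<Longrightarrow> v \<in> e \<Longrightarrow> e = {v, w}"
      using tree_has_leaf[OF less.prems True] by blast
    have v: "v \<in> verts T"
      using edge[OF vw(1)] by simp
    have "card (verts T - {v}) = Suc (card (edges T - {{v, w}}))"
      using less.hyps[OF _ tree_remove_leaf[OF less.prems vw leaf]] v fin
      by (simp add: card_gt_0_iff ne)
    then show ?thesis
      using card_Suc_Diff1[OF fin v] card_Suc_Diff1[OF finE vw(1)] by simp
  next
    case False
    then have one: "card (verts T) = 1"
      using fin ne by (metis One_nat_def Suc_lessI card_gt_0_iff)
    have "e \<notin> edges T" for e
      using edge[of e] card_mono[OF fin, of e] one by auto
    then have "edges T = {}"
      by blast
    then show ?thesis
      using one by simp
  qed
qed

section \<open>Cliques of a junction tree that contain a fixed vertex\<close>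

lemma maximal_clique_containing:
  assumes "simple_graph H" and "v \<in> verts H"
  obtains K where "K \<in> maximal_cliques H" "v \<in> K"
proof -
  have fin: "finite (verts H)"
    using assms(1) unfolding simple_graph_def by blast
  have "finite {K. clique H K \<and> v \<in> K}"
    by (rule finite_subset[of _ "Pow (verts H)"]) (auto simp: clique_def fin)
  moreover have "{v} \<in> {K. clique H K \<and> v \<in> K}"
    using assms(2) by (simp add: clique_def)
  ultimately obtain K where "K \<in> {K. clique H K \<and> v \<in> K}"
    and max: "\<And>L. L \<in> {K. clique H K \<and> v \<in> K} \<Longrightarrow> K \<subseteq> L \<Longrightarrow> K = L"
    using finite_has_maximal[of "{K. clique H K \<and> v \<in> K}"] by blast
  then have "K \<in> maximal_cliques H" "v \<in> K"
    by (auto simp: maximal_cliques_def)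
  then show ?thesis
    by (rule that)
qed

text \<open>
  The path in \<open>J\<close> between two cliques that contain \<open>i\<close> consists of cliques that contain \<open>i\<close>, by the
  clique-intersection property; hence the induced subgraph is connected. It is nonempty because \<open>i\<close>
  lies in some maximal clique of the chordal completion.
\<close>
lemma junction_tree_induced_is_tree:
  assumes J: "junction_tree G J" and i: "i \<in> verts G"
  shows "is_tree ({C \<in> verts J. i \<in> C}, {e \<in> edges J. i \<in> \<Inter>e})" (is "is_tree ?T")
proof -
  obtain H where H: "chordal_completion G H" "verts J = maximal_cliques H"
    using J unfolding junction_tree_def by blast
  have "simple_graph H" "i \<in> verts H"
    using H(1) i unfolding chordal_completion_def by auto
  then obtain K where K: "K \<in> verts J" "i \<in> K"
    using maximal_clique_containing H(2) by metis
  have simple: "finite (verts J)" "\<And>e. e \<in> edges J \<Longrightarrow> e \<subseteq> verts J \<and> card e = 2"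
    and conn: "\<And>u v. u \<in> verts J \<Longrightarrow> v \<in> verts J \<Longrightarrow> \<exists>p. graph_path J p \<and> hd p = u \<and> last p = v"
    and acyclic: "\<And>p. \<not> graph_cycle J p"
    and inter: "\<And>p C. graph_path J p \<Longrightarrow> C \<in> set p \<Longrightarrow> hd p \<inter> last p \<subseteq> C"
    using J unfolding junction_tree_def is_tree_def simple_graph_def by blast+
  have "simple_graph ?T"
    unfolding simple_graph_def using simple by auto
  moreover have "K \<in> verts ?T"
    using K by simp
  moreover have "\<not> graph_cycle ?T p" for p
    using acyclic[of p] unfolding graph_cycle_def by auto
  moreover have "\<exists>p. graph_path ?T p \<and> hd p = A \<and> last p = B"
    if "A \<in> verts ?T" "B \<in> verts ?T" for A B
  proof -
    have AB: "A \<in> verts J" "B \<in> verts J" "i \<in> A" "i \<in> B"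
      using that by auto
    obtain p where p: "graph_path J p" "hd p = A" "last p = B"
      using conn[OF AB(1,2)] by blast
    have "i \<in> C" if "C \<in> set p" for C
      using inter[OF p(1) that] p AB by blast
    then have "graph_path ?T p"
      using p(1) unfolding graph_path_def by (auto simp: successively_conv_nth)
    then show ?thesis
      using p by blast
  qed
  ultimately show ?thesis
    unfolding is_tree_def by blast
qed

section \<open>Quotients of clique and separator products\<close>

lemma prod_prod_eq_prod_power_card:
  fixes a :: "'i::finite \<Rightarrow> 'a::comm_monoid_mult"
  assumes "finite S"
  shows "(\<Prod>X\<in>S. \<Prod>i\<in>g X. a i) = (\<Prod>i\<in>UNIV. a i ^ card {X \<in> S. i \<in> g X})"
proof -
  have "(\<Prod>X\<in>S. \<Prod>i\<in>g X. a i) = (\<Prod>X\<in>S. \<Prod>i\<in>UNIV. if i \<in> g X then a i else 1)"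
    by (simp add: prod.If_cases)
  also have "\<dots> = (\<Prod>i\<in>UNIV. \<Prod>X\<in>S. if i \<in> g X then a i else 1)"
    by (rule prod.swap)
  also have "\<dots> = (\<Prod>i\<in>UNIV. a i ^ card {X \<in> S. i \<in> g X})"
    using assms by (simp add: prod.If_cases Int_def)
  finally show ?thesis .
qed

text \<open>
  Each \<open>a i\<close> occurs in the numerator once more than in the denominator, by the vertex-edge count in
  the subtree of the cliques that contain \<open>i\<close>.
\<close>
lemma junction_tree_prod_quotient:
  fixes a :: "'v::finite \<Rightarrow> 'a::field"
  assumes J: "junction_tree G J" and V: "verts G = UNIV" and nz: "\<And>i. a i \<noteq> 0"
  shows "(\<Prod>C\<in>verts J. \<Prod>i\<in>C. a i) / (\<Prod>e\<in>edges J. \<Prod>i\<in>\<Inter>e. a i) = (\<Prod>i\<in>UNIV. a i)"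
proof -
  have fin: "finite (verts J)" "finite (edges J)"
    using J unfolding junction_tree_def is_tree_def simple_graph_def
    by (blast, meson finite_Pow_iff finite_subset PowI subsetI)
  have "card {C \<in> verts J. i \<in> C} = Suc (card {e \<in> edges J. i \<in> \<Inter>e})" for i
    using tree_card_verts[OF junction_tree_induced_is_tree[OF J, of i]] V by simp
  then show ?thesis
    unfolding prod_prod_eq_prod_power_card[OF fin(1)] prod_prod_eq_prod_power_card[OF fin(2)]
      prod_dividef[symmetric]
    by (intro prod.cong refl) (simp add: nz)
qed

section \<open>Christoffel polynomials from orthonormal families\<close>

text \<open>
  Bases are sets of functions, while the bases below come as families; orthonormality itself makes
  the indexing injective.
\<close>
lemma christoffel_eq_indexed:
  assumes fin: "finite I" and mem: "\<And>i. i \<in> I \<Longrightarrow> e i \<in> V"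
    and orth: "\<And>i j. i \<in> I \<Longrightarrow> j \<in> I \<Longrightarrow> (\<integral>x. e i x * e j x \<partial>M) = (if i = j then 1 else 0)"
    and span: "\<And>v. v \<in> V \<Longrightarrow> \<exists>c. v = (\<lambda>x. \<Sum>i\<in>I. c i * e i x)"
    and int: "\<And>p q. p \<in> V \<Longrightarrow> q \<in> V \<Longrightarrow> integrable M (\<lambda>x. p x * q x)"
  shows "christoffel M V x = (\<Sum>i\<in>I. (e i x)\<^sup>2)"
proof -
  have inj: "inj_on e I"
  proof (rule inj_onI)
    fix i j assume ij: "i \<in> I" "j \<in> I" "e i = e j"
    show "i = j"
      using orth[OF ij(1) ij(1)] orth[OF ij(1) ij(2)] ij(3) by (simp split: if_splits)
  qed
  have "orthonormal_basis M V (e ` I)"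
    unfolding orthonormal_basis_def
  proof (intro conjI ballI)
    fix v assume "v \<in> V"
    then obtain c where "v = (\<lambda>x. \<Sum>i\<in>I. c i * e i x)"
      using span by blast
    then have "v = (\<lambda>x. \<Sum>p\<in>e ` I. c (inv_into I e p) * p x)"
      using inj by (simp add: sum.reindex cong: sum.cong)
    then show "\<exists>c. v = (\<lambda>x. \<Sum>p\<in>e ` I. c p * p x)"
      by (rule exI[of _ "\<lambda>p. c (inv_into I e p)"])
  qed (use fin mem orth inj in \<open>auto simp: inj_on_eq_iff\<close>)
  then have "christoffel M V x = (\<Sum>p\<in>e ` I. (p x)\<^sup>2)"
    by (rule christoffel_eq) (rule int)
  then show ?thesis
    using inj by (simp add: sum.reindex)
qed

text \<open>
  The polynomials are kept as elements of \<open>real poly\<close> rather than as functions, since the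
  construction of such a family works with their coefficients.
\<close>
definition orthonormal_polys :: "real measure \<Rightarrow> nat \<Rightarrow> (nat \<Rightarrow> real poly) \<Rightarrow> bool" where
  "orthonormal_polys \<nu> n P \<longleftrightarrow>
     (\<forall>i\<le>n. degree (P i) \<le> n) \<and>
     (\<forall>i\<le>n. \<forall>j\<le>n. (\<integral>t. poly (P i) t * poly (P j) t \<partial>\<nu>) = (if i = j then 1 else 0)) \<and>
     (\<forall>q. degree q \<le> n \<longrightarrow> (\<exists>c. q = (\<Sum>i\<le>n. smult (c i) (P i))))"

text \<open>
  Gram-Schmidt on the monomials. The induction is on the number \<open>m\<close> of polynomials, and the degree
  bound is expressed as \<open>coeff q k = 0\<close> for all \<open>k \<ge> m\<close>, so that it can start from the empty family
  and the zero polynomial.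
\<close>
lemma orthonormal_polys_exist:
  assumes int: "\<And>p. integrable \<nu> (poly p)"
    and pos: "\<And>p. p \<noteq> 0 \<Longrightarrow> (\<integral>t. poly (p * p) t \<partial>\<nu>) > 0"
  obtains P where "orthonormal_polys \<nu> n P"
proof -
  define L where "L p = (\<integral>t. poly p t \<partial>\<nu>)" for p
  have L_add: "L (p + q) = L p + L q" and L_diff: "L (p - q) = L p - L q"
    and L_smult: "L (smult c p) = c * L p" for p q c
    using int[of p] int[of q] by (simp_all add: L_def poly_diff)
  have L_sum: "L (\<Sum>i\<in>A. f i) = (\<Sum>i\<in>A. L (f i))" for A and f :: "nat \<Rightarrow> real poly"
    using int by (simp add: L_def poly_sum)
  have step: "\<exists>P. (\<forall>i<m. \<forall>k\<ge>m. coeff (P i) k = 0) \<and>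
      (\<forall>i<m. \<forall>j<m. L (P i * P j) = (if i = j then 1 else 0)) \<and>
      (\<forall>q. (\<forall>k\<ge>m. coeff q k = 0) \<longrightarrow> (\<exists>c. q = (\<Sum>i<m. smult (c i) (P i))))" for m
  proof (induction m)
    case 0
    have "q = 0" if "\<forall>k. coeff q k = 0" for q :: "real poly"
      using that by (simp add: poly_eq_iff)
    then show ?case
      by simp
  next
    case (Suc m)
    then obtain P where P: "\<forall>i<m. \<forall>k\<ge>m. coeff (P i) k = 0"
      and orth: "\<forall>i<m. \<forall>j<m. L (P i * P j) = (if i = j then 1 else 0)"
      and span: "\<forall>q. (\<forall>k\<ge>m. coeff q k = 0) \<longrightarrow> (\<exists>c. q = (\<Sum>i<m. smult (c i) (P i)))"
      by (elim exE conjE)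
    (* The monomial of degree m minus its projection onto the earlier polynomials. It is nonzero
       because its coefficient of degree m is 1. *)
    define r where "r = monom 1 m - (\<Sum>i<m. smult (L (monom 1 m * P i)) (P i))"
    define s where "s = sqrt (L (r * r))"
    have coeff_r: "coeff r k = (if k = m then 1 else 0)" if "k \<ge> m" for k
      using that P by (auto simp: r_def coeff_sum)
    then have "r \<noteq> 0"
      by (metis coeff_0 order_refl zero_neq_one)
    then have rr: "L (r * r) > 0"
      using pos by (simp add: L_def)
    then have s: "s > 0" "s * s = L (r * r)"
      by (simp_all add: s_def)
    have r_orth: "L (r * P j) = 0" if "j < m" for j
    proof -
      have "L (r * P j) = L (monom 1 m * P j)
          - (\<Sum>i<m. L (monom 1 m * P i) * (if i = j then 1 else 0))"
        using that orth
        by (simp add: r_def left_diff_distrib sum_distrib_right L_diff L_sum L_smult)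
      also have "\<dots> = 0"
        using that by (simp add: if_distrib cong: if_cong)
      finally show ?thesis .
    qed
    define Q where "Q = P(m := smult (1 / s) r)"
    have "coeff (Q i) k = 0" if "i < Suc m" "k \<ge> Suc m" for i k
      using that P coeff_r by (auto simp: Q_def less_Suc_eq)
    moreover have "L (Q i * Q j) = (if i = j then 1 else 0)" if "i < Suc m" "j < Suc m" for i j
    proof (cases "i = m"; cases "j = m")
      assume "i = m" "j = m"
      then show ?thesis
        using s(1) by (simp add: Q_def L_smult s(2)[symmetric])
    next
      assume "i = m" "j \<noteq> m"
      then show ?thesis
        using that r_orth[of j] by (simp add: Q_def L_smult)
    next
      assume "i \<noteq> m" "j = m"
      then show ?thesis
        using that r_orth[of i] by (simp add: Q_def L_smult mult.commute[of _ r])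
    next
      assume "i \<noteq> m" "j \<noteq> m"
      then show ?thesis
        using that orth by (simp add: Q_def)
    qed
    moreover have "\<exists>c. q = (\<Sum>i<Suc m. smult (c i) (Q i))"
      if q: "\<And>k. k \<ge> Suc m \<Longrightarrow> coeff q k = 0" for q
    proof -
      have "coeff (q - smult (coeff q m) r) k = 0" if "k \<ge> m" for k
        using that q coeff_r by (cases "k = m") auto
      then obtain c where "q - smult (coeff q m) r = (\<Sum>i<m. smult (c i) (P i))"
        using span by blast
      then have "q = (\<Sum>i<m. smult (c i) (P i)) + smult (coeff q m) r"
        by (simp add: diff_eq_eq)
      also have "\<dots> = (\<Sum>i<Suc m. smult ((c(m := coeff q m * s)) i) (Q i))"
        using s(1) by (simp add: Q_def)
      finally show ?thesis
        by blast
    qed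
    ultimately show ?case
      by blast
  qed
  obtain P where "\<forall>i<Suc n. \<forall>k\<ge>Suc n. coeff (P i) k = 0"
      "\<forall>i<Suc n. \<forall>j<Suc n. L (P i * P j) = (if i = j then 1 else 0)"
      "\<forall>q. (\<forall>k\<ge>Suc n. coeff q k = 0) \<longrightarrow> (\<exists>c. q = (\<Sum>i<Suc n. smult (c i) (P i)))"
    using step by blast
  then have "orthonormal_polys \<nu> n P"
    unfolding orthonormal_polys_def
    by (simp add: L_def less_Suc_eq_le lessThan_Suc_atMost Suc_le_eq coeff_eq_0 degree_le)
  then show ?thesis
    by (rule that)
qed

lemma univ_christoffel_eq:
  assumes int: "\<And>p. integrable \<nu> (poly p)" and P: "orthonormal_polys \<nu> n P"
  shows "univ_christoffel n \<nu> t = (\<Sum>j\<le>n. (poly (P j) t)\<^sup>2)"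
  unfolding univ_christoffel_def
proof (rule christoffel_eq_indexed)
  fix v assume "v \<in> univ_polys n"
  then obtain q where q: "v = poly q" "degree q \<le> n"
    by (auto simp: univ_polys_def)
  then obtain c where "q = (\<Sum>i\<le>n. smult (c i) (P i))"
    using P unfolding orthonormal_polys_def by blast
  then have "v = (\<lambda>x. \<Sum>i\<le>n. c i * poly (P i) x)"
    using q(1) by (simp add: poly_sum fun_eq_iff)
  then show "\<exists>c. v = (\<lambda>x. \<Sum>i\<le>n. c i * poly (P i) x)"
    by blast
next
  fix p q assume "p \<in> univ_polys n" "q \<in> univ_polys n"
  then obtain p' q' where "p = poly p'" "q = poly q'"
    by (auto simp: univ_polys_def)
  then show "integrable \<nu> (\<lambda>x. p x * q x)"
    using int[of "p' * q'"] by (simp add: poly_mult[abs_def])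
qed (use P in \<open>auto simp: orthonormal_polys_def univ_polys_def\<close>)

text \<open>The constant 1 is in the span of the family, so the family has no common zero.\<close>
lemma univ_christoffel_pos:
  assumes "\<And>p. integrable \<nu> (poly p)" and P: "orthonormal_polys \<nu> n P"
  shows "univ_christoffel n \<nu> t > 0"
proof -
  obtain c where "[:1:] = (\<Sum>i\<le>n. smult (c i) (P i))"
    using P unfolding orthonormal_polys_def by (metis degree_pCons_0 zero_le)
  then have "poly [:1:] t = (\<Sum>i\<le>n. c i * poly (P i) t)"
    by (simp only: poly_sum poly_smult)
  then have "\<exists>i\<le>n. poly (P i) t \<noteq> 0"
    by (cases "\<forall>i\<le>n. poly (P i) t = 0") auto
  then show ?thesis
    unfolding univ_christoffel_eq[OF assms] by (auto intro!: sum_pos2)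
qed

section \<open>Moments, definiteness and tensor polynomials\<close>

lemma integrable_poly_of_bounded:
  fixes \<nu> :: "real measure"
  assumes "finite_measure \<nu>" and sets: "sets \<nu> = sets borel" and bdd: "AE t in \<nu>. \<bar>t\<bar> \<le> R"
  shows "integrable \<nu> (poly p)"
proof -
  interpret finite_measure \<nu> by fact
  have "bounded (poly p ` cball 0 R)"
    by (intro compact_imp_bounded compact_continuous_image continuous_intros) auto
  then obtain B where "\<And>t. t \<in> cball 0 R \<Longrightarrow> norm (poly p t) \<le> B"
    unfolding bounded_iff by blast
  then have "AE t in \<nu>. norm (poly p t) \<le> B"
    using bdd by (auto elim!: eventually_mono)
  moreover have "poly p \<in> borel_measurable \<nu>"
    using borel_measurable_continuous_onI[of "\<lambda>t. poly p t"]
    by (simp add: measurable_cong_sets[OF sets refl] continuous_on_poly)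
  ultimately show ?thesis
    by (rule integrable_const_bound)
qed

text \<open>
  If the integral vanished, the polynomial would vanish almost everywhere; but its finitely many
  roots are a null set for a measure without atoms.
\<close>
lemma integral_poly_square_pos:
  fixes \<nu> :: "real measure"
  assumes int: "\<And>p. integrable \<nu> (poly p)" and sets: "sets \<nu> = sets borel"
    and nz: "emeasure \<nu> UNIV \<noteq> 0" and atomless: "\<And>t. emeasure \<nu> {t} = 0" and p: "p \<noteq> 0"
  shows "(\<integral>t. poly (p * p) t \<partial>\<nu>) > 0"
proof (rule ccontr)
  assume "\<not> ?thesis"
  moreover have "(\<integral>t. poly (p * p) t \<partial>\<nu>) \<ge> 0"
    by (simp add: Bochner_Integration.integral_nonneg)
  ultimately have "(\<integral>t. poly (p * p) t \<partial>\<nu>) = 0"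
    by linarith
  then have zero: "AE t in \<nu>. poly (p * p) t = 0"
    by (subst (asm) integral_nonneg_eq_0_iff_AE) (auto intro: int)
  have "{t. poly p t = 0} = (\<Union>t\<in>{t. poly p t = 0}. {t})"
    by blast
  also have "\<dots> \<in> null_sets \<nu>"
    using poly_roots_finite[OF p]
    by (intro null_sets_UN') (auto simp: null_sets_def sets atomless countable_finite)
  finally have "AE t in \<nu>. poly p t \<noteq> 0"
    by (rule AE_I') auto
  with zero have "AE t in \<nu>. False"
    by eventually_elim auto
  then show False
    using nz sets_eq_imp_space_eq[OF sets] AE_iff_measurable[of UNIV \<nu> "\<lambda>_. False"]
    by (simp add: sets)
qed

lemma prod_poly_in_tensor_polys:
  fixes D :: "'d::finite set"
  assumes "\<And>k. k \<in> D \<Longrightarrow> degree (q k) \<le> n"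
  shows "(\<lambda>x. \<Prod>k\<in>D. poly (q k) (x $ k)) \<in> tensor_polys D n"
proof -
  have "(\<Prod>k\<in>D. poly (q k) (x $ k)) =
      (\<Sum>a\<in>(\<Pi>\<^sub>E k\<in>D. {..n}). (\<Prod>k\<in>D. coeff (q k) (a k)) * (\<Prod>k\<in>D. (x $ k) ^ a k))"
    for x :: "real ^ 'd"
  proof -
    have "(\<Prod>k\<in>D. poly (q k) (x $ k)) = (\<Prod>k\<in>D. \<Sum>i\<le>n. coeff (q k) i * (x $ k) ^ i)"
    proof (rule prod.cong[OF refl])
      fix k assume "k \<in> D"
      then show "poly (q k) (x $ k) = (\<Sum>i\<le>n. coeff (q k) i * (x $ k) ^ i)"
        using arg_cong[OF poly_as_sum_of_monoms'[OF assms], of k "\<lambda>p. poly p (x $ k)"]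
        by (simp add: poly_sum poly_monom)
    qed
    then show ?thesis
      by (simp add: prod_sum_PiE prod.distrib)
  qed
  then show ?thesis
    unfolding tensor_polys_def mem_Collect_eq
    by (intro exI[of _ "\<lambda>a. \<Prod>k\<in>D. coeff (q k) (a k)"]) (simp add: fun_eq_iff)
qed

text \<open>
  The complement of the support is the union of all open null sets; in a second-countable space
  countably many of them suffice.
\<close>
lemma AE_in_measure_support:
  fixes M :: "'a::second_countable_topology measure"
  assumes "sets M = sets borel"
  shows "AE x in M. x \<in> measure_support M"
proof -
  obtain \<U> where \<U>: "\<U> \<subseteq> {U. open U \<and> emeasure M U = 0}" "countable \<U>"
      "\<Union>\<U> = \<Union>{U. open U \<and> emeasure M U = 0}"
    using Lindelof[of "{U. open U \<and> emeasure M U = 0}"] by blast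
  have "(\<Union>U\<in>\<U>. U) \<in> null_sets M"
    using \<U>(1,2) assms by (intro null_sets_UN') (auto simp: null_sets_def)
  moreover have "{x \<in> space M. x \<notin> measure_support M} \<subseteq> (\<Union>U\<in>\<U>. U)"
    using \<U>(3) by (auto simp: measure_support_def not_gr_zero)
  ultimately show ?thesis
    by (rule AE_I')
qed

section \<open>Product measures and their marginals\<close>

text \<open>
  The factors may have any masses with product 1; the marginals of \<open>M\<close> thus involve these masses.
\<close>
locale product_prob_space_vec =
  fixes \<mu> :: "'d::finite \<Rightarrow> real measure" and M :: "(real ^ 'd) measure"
  assumes finite_factor: "\<And>i. finite_measure (\<mu> i)"
    and sets_factor: "\<And>i. sets (\<mu> i) = sets borel"
    and M_eq: "M = distr (\<Pi>\<^sub>M i\<in>UNIV. \<mu> i) borel (\<lambda>y. \<chi> i. y i)"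
    and prob: "prob_space M"
begin

sublocale product_sigma_finite \<mu>
  unfolding product_sigma_finite_def using finite_factor by (simp add: finite_measure_def)

definition mass :: "'d \<Rightarrow> real" where
  "mass i = measure (\<mu> i) UNIV"

lemma space_factor: "space (\<mu> i) = UNIV"
  using sets_eq_imp_space_eq[OF sets_factor] by simp

lemma measurable_nth: "(\<lambda>x :: real ^ 'd. x $ i) \<in> borel_measurable borel"
  by (intro borel_measurable_continuous_onI continuous_intros)

lemma measurable_vec: "(\<lambda>y. \<chi> i. y i) \<in> (\<Pi>\<^sub>M i\<in>UNIV. \<mu> i) \<rightarrow>\<^sub>M (borel :: (real ^ 'd) measure)"
proof -
  have coord: "(\<lambda>y. y i) \<in> borel_measurable (\<Pi>\<^sub>M i\<in>UNIV. \<mu> i)" for i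
    using measurable_component_singleton[of i UNIV \<mu>]
    by (simp add: measurable_cong_sets[OF refl sets_factor])
  show ?thesis
  proof (rule borel_measurable_euclidean_space[THEN iffD2], rule ballI)
    fix b :: "real ^ 'd" assume "b \<in> Basis"
    then obtain i where "b = axis i 1"
      by (auto simp: Basis_vec_def)
    then show "(\<lambda>y. (\<chi> i. y i) \<bullet> b) \<in> borel_measurable (\<Pi>\<^sub>M i\<in>UNIV. \<mu> i)"
      using coord by (simp only: inner_axis vec_lambda_beta inner_real_def mult_1_right)
  qed
qed

text \<open>
  Through this formula, null sets of \<open>M\<close> that depend on one coordinate become null sets of the
  corresponding factor.
\<close>
lemma emeasure_coordinate:
  assumes S: "S \<in> sets borel"
  shows "emeasure M {x. x $ i \<in> S} = emeasure (\<mu> i) S * (\<Prod>k\<in>- {i}. emeasure (\<mu> k) UNIV)"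
proof -
  have "{x :: real ^ 'd. x $ i \<in> S} \<in> sets borel"
    using measurable_sets[OF measurable_nth S, of i] by (simp add: vimage_def)
  moreover have "(\<lambda>y. \<chi> i. y i) -` {x :: real ^ 'd. x $ i \<in> S} \<inter> space (\<Pi>\<^sub>M i\<in>UNIV. \<mu> i)
      = (\<Pi>\<^sub>E k\<in>UNIV. if k = i then S else UNIV)"
    by (auto simp: space_PiM space_factor PiE_iff split: if_splits)
  ultimately have "emeasure M {x. x $ i \<in> S}
      = emeasure (\<Pi>\<^sub>M i\<in>UNIV. \<mu> i) (\<Pi>\<^sub>E k\<in>UNIV. if k = i then S else UNIV)"
    unfolding M_eq
    by (simp add: emeasure_distr[OF measurable_vec])
  also have "\<dots> = (\<Prod>k\<in>UNIV. if k = i then emeasure (\<mu> k) S else emeasure (\<mu> k) UNIV)"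
  proof (subst emeasure_PiM)
    show "(if k = i then S else UNIV) \<in> sets (\<mu> k)" for k
      using S by (simp add: sets_factor)
  qed (auto intro: prod.cong)
  also have "\<dots> = emeasure (\<mu> i) S * (\<Prod>k\<in>- {i}. emeasure (\<mu> k) UNIV)"
    by (simp add: prod.If_cases)
  finally show ?thesis .
qed

lemma emeasure_factor_nz: "emeasure (\<mu> i) UNIV \<noteq> 0"
  and emeasure_others_nz: "(\<Prod>k\<in>- {i}. emeasure (\<mu> k) UNIV) \<noteq> 0"
proof -
  have nz: "a \<noteq> 0 \<and> b \<noteq> 0" if "a * b = 1" for a b :: ennreal
    using that by auto
  have "emeasure (\<mu> i) UNIV * (\<Prod>k\<in>- {i}. emeasure (\<mu> k) UNIV) = 1"
    using emeasure_coordinate[of UNIV i] prob_space.emeasure_space_1[OF prob]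
    by (simp add: M_eq)
  then show "emeasure (\<mu> i) UNIV \<noteq> 0" "(\<Prod>k\<in>- {i}. emeasure (\<mu> k) UNIV) \<noteq> 0"
    using nz by blast+
qed

lemma emeasure_factor_eq_0:
  assumes "S \<in> sets borel" and "emeasure M {x. x $ i \<in> S} = 0"
  shows "emeasure (\<mu> i) S = 0"
  using assms(2) emeasure_others_nz[of i]
  unfolding emeasure_coordinate[OF assms(1)] mult_eq_0_iff by blast

lemma mass_pos: "mass i > 0"
proof -
  have "measure (\<mu> i) UNIV \<noteq> 0"
    using emeasure_factor_nz[of i] finite_measure.emeasure_eq_measure[OF finite_factor, of i UNIV]
    by (metis ennreal_0)
  then show ?thesis
    by (simp add: mass_def zero_less_measure_iff)
qed

text \<open>
  Fubini for functions of product form: each coordinate outside \<open>C\<close> is integrated out and leaves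
  the total mass of its factor.
\<close>
lemma
  assumes g: "\<And>k. k \<in> C \<Longrightarrow> integrable (\<mu> k) (g k :: real \<Rightarrow> real)"
  shows integrable_marginal_prod: "integrable (marginal C M) (\<lambda>x. \<Prod>k\<in>C. g k (x $ k))" (is ?int)
    and integral_marginal_prod:
      "(\<integral>x. (\<Prod>k\<in>C. g k (x $ k)) \<partial>marginal C M) = (\<Prod>k\<in>C. \<integral>t. g k t \<partial>\<mu> k) * (\<Prod>k\<in>- C. mass k)"
      (is ?eq)
proof -
  define h where "h k = (if k \<in> C then g k else (\<lambda>_. 1))" for k
  have h: "integrable (\<mu> k) (h k)" for k
    using g finite_factor[of k] by (simp add: h_def finite_measure.integrable_const)
  have proj: "coord_proj C \<in> (borel :: (real ^ 'd) measure) \<rightarrow>\<^sub>M borel"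
    unfolding coord_proj_def[abs_def]
  proof (intro borel_measurable_continuous_onI continuous_on_vec_lambda)
    show "continuous_on UNIV (\<lambda>x :: real ^ 'd. if k \<in> C then x $ k else 0)" for k
      by (cases "k \<in> C") (simp_all add: continuous_on_component)
  qed
  have marginal_eq: "marginal C M = distr (\<Pi>\<^sub>M i\<in>UNIV. \<mu> i) borel (\<lambda>y. coord_proj C (\<chi> i. y i))"
    unfolding marginal_def M_eq by (subst distr_distr[OF proj measurable_vec]) (simp add: comp_def)
  have T: "(\<lambda>y. coord_proj C (\<chi> i. y i)) \<in> (\<Pi>\<^sub>M i\<in>UNIV. \<mu> i) \<rightarrow>\<^sub>M borel"
    using measurable_compose[OF measurable_vec proj] .
  have meas: "(\<lambda>x. \<Prod>k\<in>C. g k (x $ k)) \<in> borel_measurable borel"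
  proof (rule borel_measurable_prod)
    fix k assume "k \<in> C"
    then have "g k \<in> borel_measurable borel"
      using g[of k] measurable_cong_sets[OF sets_factor[of k] refl]
      by (auto dest: borel_measurable_integrable)
    then show "(\<lambda>x. g k (x $ k)) \<in> borel_measurable borel"
      by (rule measurable_compose[OF measurable_nth])
  qed
  have pullback: "(\<Prod>k\<in>C. g k (coord_proj C (\<chi> i. y i) $ k)) = (\<Prod>k\<in>UNIV. h k (y k))" for y
  proof -
    have "(\<Prod>k\<in>UNIV. h k (y k)) = (\<Prod>k\<in>UNIV. if k \<in> C then g k (y k) else 1)"
      by (intro prod.cong) (auto simp: h_def)
    then show ?thesis
      by (simp add: prod.If_cases coord_proj_def)
  qed
  show ?int
    unfolding marginal_eq integrable_distr_eq[OF T meas] pullback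
    by (rule product_integrable_prod) (auto intro: h)
  have "(\<integral>x. (\<Prod>k\<in>C. g k (x $ k)) \<partial>marginal C M) = (\<Prod>k\<in>UNIV. \<integral>t. h k t \<partial>\<mu> k)"
    unfolding marginal_eq integral_distr[OF T meas] pullback
    by (rule product_integral_prod) (auto intro: h)
  also have "\<dots> = (\<Prod>k\<in>UNIV. if k \<in> C then \<integral>t. g k t \<partial>\<mu> k else mass k)"
    by (intro prod.cong) (auto simp: h_def mass_def space_factor)
  finally show ?eq
    by (simp add: prod.If_cases Compl_eq)
qed

lemma prod_mass: "(\<Prod>k\<in>UNIV. mass k) = 1"
proof -
  have "prob_space (marginal {} M)"
    unfolding marginal_def coord_proj_def[abs_def]
    using prob by (intro prob_space.prob_space_distr) auto
  then show ?thesis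
    using integral_marginal_prod[of "{}"] by (simp add: prob_space.prob_space)
qed

text \<open>
  The products \<open>e a\<close> of univariate orthonormal polynomials, one for each exponent vector \<open>a\<close>, are
  an orthonormal basis. The factors \<open>sqrt (mass k)\<close>, \<open>k \<in> C\<close>, contribute \<open>\<Prod>k\<in>C. mass k\<close> to the inner
  products, which together with the mass of the remaining coordinates gives \<open>prod_mass\<close>, that is, 1.
  The sum of the squares then factorizes because it ranges over a full box of exponent vectors.
\<close>
lemma coord_christoffel_marginal:
  assumes int: "\<And>k p. integrable (\<mu> k) (poly p)" and P: "\<And>k. orthonormal_polys (\<mu> k) n (P k)"
  shows "coord_christoffel C n (marginal C M) x = (\<Prod>k\<in>C. mass k * univ_christoffel n (\<mu> k) (x $ k))"
proof -
  have deg: "\<And>k i. i \<le> n \<Longrightarrow> degree (P k i) \<le> n"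
    and orth: "\<And>k i j. i \<le> n \<Longrightarrow> j \<le> n \<Longrightarrow>
      (\<integral>t. poly (P k i) t * poly (P k j) t \<partial>\<mu> k) = (if i = j then 1 else 0)"
    and span: "\<And>k q. degree q \<le> n \<Longrightarrow> \<exists>c. q = (\<Sum>i\<le>n. smult (c i) (P k i))"
    using P unfolding orthonormal_polys_def by blast+
  define I :: "('d \<Rightarrow> nat) set" where "I = (\<Pi>\<^sub>E k\<in>C. {..n})"
  define e where "e a x = (\<Prod>k\<in>C. sqrt (mass k) * poly (P k (a k)) (x $ k))" for a and x :: "real ^ 'd"
  have fin: "finite I"
    unfolding I_def by (intro finite_PiE) auto
  have I_le: "a k \<le> n" if "a \<in> I" "k \<in> C" for a k
    using that by (auto simp: I_def)
  have "coord_christoffel C n (marginal C M) x = (\<Sum>a\<in>I. (e a x)\<^sup>2)"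
    unfolding coord_christoffel_def
  proof (rule christoffel_eq_indexed[OF fin])
    show "e a \<in> tensor_polys C n" if "a \<in> I" for a
      using prod_poly_in_tensor_polys[of C "\<lambda>k. smult (sqrt (mass k)) (P k (a k))" n] deg I_le that
      by (simp add: e_def[abs_def])
  next
    fix a b assume ab: "a \<in> I" "b \<in> I"
    have int_ab: "integrable (\<mu> k) (\<lambda>t. mass k * (poly (P k (a k)) t * poly (P k (b k)) t))" for k
      using int[of k "P k (a k) * P k (b k)"] by (simp add: poly_mult[abs_def])
    have "e a x * e b x = (\<Prod>k\<in>C. mass k * (poly (P k (a k)) (x $ k) * poly (P k (b k)) (x $ k)))" for x
      unfolding e_def prod.distrib[symmetric]
      using mass_pos by (intro prod.cong) (auto simp: field_simps less_imp_le)
    then have "(\<integral>x. e a x * e b x \<partial>marginal C M)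
        = (\<Prod>k\<in>C. mass k * (if a k = b k then 1 else 0)) * (\<Prod>k\<in>- C. mass k)"
      using ab I_le by (simp add: integral_marginal_prod[OF int_ab] orth cong: prod.cong)
    also have "\<dots> = (\<Prod>k\<in>C. if a k = b k then 1 else 0) * ((\<Prod>k\<in>C. mass k) * (\<Prod>k\<in>- C. mass k))"
      by (simp add: prod.distrib)
    also have "(\<Prod>k\<in>C. mass k) * (\<Prod>k\<in>- C. mass k) = 1"
      using prod_mass prod.union_disjoint[of C "- C" mass] by simp
    also have "(\<Prod>k\<in>C. if a k = b k then 1 else 0) * 1 = (if a = b then 1 else 0 :: real)"
    proof (cases "a = b")
      case False
      then obtain k where "k \<in> C" "a k \<noteq> b k"
        using ab unfolding I_def by (meson PiE_ext)
      then show ?thesis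
        using False by (auto simp: prod_zero_iff)
    qed simp
    finally show "(\<integral>x. e a x * e b x \<partial>marginal C M) = (if a = b then 1 else 0)" .
  next
    fix v :: "real ^ 'd \<Rightarrow> real" assume "v \<in> tensor_polys C n"
    then obtain c where v: "v = (\<lambda>x. \<Sum>a\<in>I. c a * (\<Prod>k\<in>C. (x $ k) ^ a k))"
      unfolding tensor_polys_def I_def by blast
    (* d k j holds the coordinates of the monomial of degree j in the basis P k; expanding the
       product over k turns them into coordinates in the basis e. *)
    define d where "d k j = (SOME d. monom 1 j = (\<Sum>i\<le>n. smult (d i) (P k i)))" for k j
    have d: "monom 1 j = (\<Sum>i\<le>n. smult (d k j i) (P k i))" if "j \<le> n" for k j
    proof -
      have "degree (monom 1 j :: real poly) \<le> n"
        using that by (simp add: degree_monom_eq)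
      from someI_ex[OF span[OF this, of k]] show ?thesis
        unfolding d_def .
    qed
    have pow: "t ^ j = (\<Sum>i\<le>n. d k j i * poly (P k i) t)" if "j \<le> n" for k j t
      using arg_cong[OF d[OF that, of k], of "\<lambda>p. poly p t"] by (simp add: poly_monom poly_sum)
    have monomial: "(\<Prod>k\<in>C. (x $ k) ^ a k)
        = (\<Sum>b\<in>I. (\<Prod>k\<in>C. d k (a k) (b k) / sqrt (mass k)) * e b x)" if "a \<in> I" for a and x :: "real ^ 'd"
    proof -
      have "(\<Prod>k\<in>C. (x $ k) ^ a k) = (\<Prod>k\<in>C. \<Sum>i\<le>n. d k (a k) i * poly (P k i) (x $ k))"
        using I_le[OF that] by (intro prod.cong pow) auto
      also have "\<dots> = (\<Sum>b\<in>I. \<Prod>k\<in>C. d k (a k) (b k) * poly (P k (b k)) (x $ k))"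
        unfolding I_def by (rule prod_sum_PiE) auto
      also have "\<dots> = (\<Sum>b\<in>I. (\<Prod>k\<in>C. d k (a k) (b k) / sqrt (mass k)) * e b x)"
        unfolding e_def prod.distrib[symmetric]
        using mass_pos by (intro sum.cong prod.cong) (auto simp: less_imp_neq[symmetric])
      finally show ?thesis .
    qed
    have "v = (\<lambda>x. \<Sum>b\<in>I. (\<Sum>a\<in>I. c a * (\<Prod>k\<in>C. d k (a k) (b k) / sqrt (mass k))) * e b x)"
    proof
      fix x
      have "v x = (\<Sum>a\<in>I. c a * (\<Sum>b\<in>I. (\<Prod>k\<in>C. d k (a k) (b k) / sqrt (mass k)) * e b x))"
        by (simp add: v monomial cong: sum.cong)
      also have "\<dots> = (\<Sum>b\<in>I. (\<Sum>a\<in>I. c a * (\<Prod>k\<in>C. d k (a k) (b k) / sqrt (mass k))) * e b x)"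
        unfolding sum_distrib_left sum_distrib_right
        by (subst sum.swap) (simp add: mult.assoc)
      finally show "v x = \<dots>" .
    qed
    then show "\<exists>c. v = (\<lambda>x. \<Sum>b\<in>I. c b * e b x)"
      by (rule exI[of _ "\<lambda>b. \<Sum>a\<in>I. c a * (\<Prod>k\<in>C. d k (a k) (b k) / sqrt (mass k))"])
  next
    fix p q :: "real ^ 'd \<Rightarrow> real" assume "p \<in> tensor_polys C n" "q \<in> tensor_polys C n"
    then obtain c c' where pq: "p = (\<lambda>x. \<Sum>a\<in>I. c a * (\<Prod>k\<in>C. (x $ k) ^ a k))"
        "q = (\<lambda>x. \<Sum>a\<in>I. c' a * (\<Prod>k\<in>C. (x $ k) ^ a k))"
      unfolding tensor_polys_def I_def by blast
    have "p x * q x = (\<Sum>a\<in>I. \<Sum>b\<in>I. c a * c' b * (\<Prod>k\<in>C. (x $ k) ^ (a k + b k)))" for x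
      unfolding pq sum_product
      by (intro sum.cong refl) (simp add: power_add prod.distrib mult_ac)
    moreover have "integrable (marginal C M) (\<lambda>x. \<Prod>k\<in>C. (x $ k) ^ (a k + b k))" for a b
      by (rule integrable_marginal_prod)
         (use int[of _ "monom 1 _"] in \<open>simp add: poly_monom[abs_def]\<close>)
    ultimately show "integrable (marginal C M) (\<lambda>x. p x * q x)"
      by simp
  qed
  also have "\<dots> = (\<Sum>a\<in>I. \<Prod>k\<in>C. mass k * (poly (P k (a k)) (x $ k))\<^sup>2)"
    using mass_pos by (simp add: e_def prod_power_distrib power_mult_distrib less_imp_le)
  also have "\<dots> = (\<Prod>k\<in>C. \<Sum>j\<le>n. mass k * (poly (P k j) (x $ k))\<^sup>2)"
    unfolding I_def by (rule prod_sum_PiE[symmetric]) auto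
  also have "\<dots> = (\<Prod>k\<in>C. mass k * univ_christoffel n (\<mu> k) (x $ k))"
    by (simp add: univ_christoffel_eq[OF int P] sum_distrib_left)
  finally show ?thesis .
qed

text \<open>
  The compact support of \<open>M\<close> lies in some ball of radius \<open>R\<close>, so \<open>\<mu> i\<close> lives on \<open>[-R, R]\<close>, where
  polynomials are bounded.
\<close>
lemma integrable_factor_poly:
  assumes "compact (measure_support M)"
  shows "integrable (\<mu> i) (poly p)"
proof -
  have sets_M: "sets M = sets borel"
    by (simp add: M_eq)
  obtain R where R: "\<And>x. x \<in> measure_support M \<Longrightarrow> norm x \<le> R"
    using compact_imp_bounded[OF assms] unfolding bounded_iff by blast
  let ?S = "{t :: real. \<not> \<bar>t\<bar> \<le> R}"
  have S: "?S \<in> sets borel"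
    by measurable
  have "AE x in M. \<bar>x $ i\<bar> \<le> R"
    using AE_in_measure_support[OF sets_M]
    by eventually_elim (metis R component_le_norm_cart order_trans)
  moreover have "{x :: real ^ 'd. x $ i \<in> ?S} \<in> sets M"
    using measurable_sets[OF measurable_nth S, of i] by (simp add: vimage_def sets_M)
  ultimately have "emeasure M {x. x $ i \<in> ?S} = 0"
    using AE_iff_measurable[of "{x. x $ i \<in> ?S}" M "\<lambda>x. \<bar>x $ i\<bar> \<le> R"]
      sets_eq_imp_space_eq[OF sets_M] by simp
  then have "emeasure (\<mu> i) ?S = 0"
    by (rule emeasure_factor_eq_0[OF S])
  then have "AE t in \<mu> i. \<bar>t\<bar> \<le> R"
    using AE_iff_measurable[of ?S "\<mu> i" "\<lambda>t. \<bar>t\<bar> \<le> R"] S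
    by (simp add: space_factor sets_factor)
  then show ?thesis
    by (rule integrable_poly_of_bounded[OF finite_factor sets_factor])
qed

text \<open>
  An atom of a factor would give positive mass to a hyperplane, which is a Lebesgue null set.
\<close>
lemma emeasure_factor_singleton:
  assumes f: "f \<in> borel_measurable lborel" and M_dens: "M = density lborel f"
  shows "emeasure (\<mu> i) {t} = 0"
proof (rule emeasure_factor_eq_0)
  have sets: "{x :: real ^ 'd. x $ i \<in> {t}} \<in> sets lborel"
    using measurable_sets[OF measurable_nth, of "{t}" i] by (simp add: vimage_def)
  have "negligible {x :: real ^ 'd. axis i 1 \<bullet> x = t}"
    by (rule negligible_hyperplane) (simp add: axis_eq_0_iff)
  then have "negligible {x :: real ^ 'd. x $ i \<in> {t}}"
    by (simp add: inner_axis')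
  then have "{x :: real ^ 'd. x $ i \<in> {t}} \<in> null_sets lborel"
    using null_sets_completion_iff[OF sets] by (simp add: negligible_iff_null_sets)
  then have "{x :: real ^ 'd. x $ i \<in> {t}} \<in> null_sets M"
    using absolutely_continuousI_density[OF f] unfolding M_dens absolutely_continuous_def by blast
  then show "emeasure M {x. x $ i \<in> {t}} = 0"
    by (simp add: null_sets_def)
qed simp

end

section \<open>The rational Christoffel function of a product measure\<close>

theorem proposition4p3:
  fixes M :: "(real ^ 'd::finite) measure"
    and f :: "real ^ 'd \<Rightarrow> ennreal"
    and \<mu> :: "'d \<Rightarrow> real measure"
    and G :: "'d graph"
    and J :: "'d set graph"
    and n :: nat
    and x :: "real ^ 'd"
  assumes "prob_space M"
    and "compact (measure_support M)"
    and "f \<in> borel_measurable lborel"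
    and "M = density lborel f"
    and "\<And>i. finite_measure (\<mu> i)"
    and "\<And>i. sets (\<mu> i) = sets borel"
    and "M = distr (\<Pi>\<^sub>M i\<in>UNIV. \<mu> i) borel (\<lambda>y. \<chi> i. y i)"
    and "graphical_model G f"
    and "junction_tree G J"
  shows "rational_christoffel n M J x = (\<Prod>i\<in>UNIV. univ_christoffel n (\<mu> i) (x $ i)) \<and>
         (\<Prod>i\<in>UNIV. univ_christoffel n (\<mu> i) (x $ i)) = coord_christoffel UNIV n M x"
proof -
  interpret product_prob_space_vec \<mu> M
    by (intro product_prob_space_vec.intro assms(1,5-7))
  have int: "integrable (\<mu> k) (poly p)" for k p
    by (rule integrable_factor_poly) (rule assms(2))
  have "\<exists>P. orthonormal_polys (\<mu> k) n P" for k
    using orthonormal_polys_exist[OF int integral_poly_square_pos[OF int sets_factor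
      emeasure_factor_nz emeasure_factor_singleton[OF assms(3,4)]]] by metis
  then obtain P where P: "\<And>k. orthonormal_polys (\<mu> k) n (P k)"
    by metis
  define a where "a k = mass k * univ_christoffel n (\<mu> k) (x $ k)" for k
  have christoffel: "coord_christoffel C n (marginal C M) (coord_proj C x) = (\<Prod>k\<in>C. a k)" for C
    unfolding coord_christoffel_marginal[OF int P] a_def
    by (intro prod.cong) (simp_all add: coord_proj_def)
  have a_nz: "a k \<noteq> 0" for k
    using mass_pos[of k] univ_christoffel_pos[OF int P, of k "x $ k"] by (simp add: a_def)
  have prod_a: "(\<Prod>k\<in>UNIV. a k) = (\<Prod>k\<in>UNIV. univ_christoffel n (\<mu> k) (x $ k))"
    by (simp add: a_def prod.distrib prod_mass)
  have "verts G = UNIV"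
    using assms(8) by (simp add: graphical_model_def)
  then have "rational_christoffel n M J x = (\<Prod>k\<in>UNIV. a k)"
    unfolding rational_christoffel_def christoffel
    using junction_tree_prod_quotient[OF assms(9)] a_nz by blast
  moreover have "coord_christoffel UNIV n M x = (\<Prod>k\<in>UNIV. a k)"
  proof -
    have "coord_proj UNIV = (\<lambda>x :: real ^ 'd. x)"
      by (simp add: coord_proj_def[abs_def])
    moreover from this have "marginal UNIV M = M"
      by (simp add: marginal_def M_eq distr_id2)
    ultimately show ?thesis
      using christoffel[of UNIV] by simp
  qed
  ultimately show ?thesis
    by (simp add: prod_a)
qed

end
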